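(* Let $R$ be a ring and $\alpha$ an endomorphism of $R$. Then the following conditions are equivalent: (i) the skew polynomial ring $R[x;\alpha]$ is a reduced right Archimedean ring; (ii) $R[x;\alpha]$ is a right Archimedean domain; (iii) $R$ is a right Archimedean domain, $\alpha$ is injective and $\alpha$ preserves nonunits of $R$.
   Context: Rings are associative with unity $1\neq 0$, not necessarily commutative; endomorphisms are (unital) ring endomorphisms. $U(A)$ denotes the group of units (two-sided invertible elements) of a ring $A$; elements of $A\setminus U(A)$ are called nonunits. $\mathbb{N}$ is the set of positive integers. A ring $A$ is right Archimedean if $\bigcap_{n\in\mathbb{N}} Aa^n = 0$ for every $a\in A\setminus U(A)$. A ring is reduced if it has no nonzero nilpotent elements. A domain is a (not necessarily commutative) ring in which the product of any two nonzero elements is nonzero. The skew polynomial ring $R[x;\alpha]$ consists of polynomials over $R$ in the variable $x$ with coefficients written on the left of powers of $x$, with term-wise addition and with multiplication subject to the relation $xa=\alpha(a)x$ for $a\in R$. The endomorphism $\alpha$ preserves nonunits of $R$ if $\alpha(R\setminus U(R))\subseteq R\setminus U(R)$. *)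

theory Defs
  imports "HOL-Algebra.UnivPoly"
begin

text \<open>
  The locale \<^locale>\<open>ring\<close> admits the zero ring and \<^locale>\<open>domain\<close> is commutative by
  definition, so neither can be used as is.
\<close>

locale nonzero_ring = ring R for R (structure) +
  assumes one_not_zero [simp]: "\<one> \<noteq> \<zero>"

locale reduced_ring = nonzero_ring R for R (structure) +
  assumes nilpotent_imp_zero:
    "\<And>a (n::nat). \<lbrakk>a \<in> carrier R; a [^] n = \<zero>\<rbrakk> \<Longrightarrow> a = \<zero>"

locale noncomm_domain = nonzero_ring R for R (structure) +
  assumes mult_nonzero:
    "\<And>a b. \<lbrakk>a \<in> carrier R; b \<in> carrier R; a \<noteq> \<zero>; b \<noteq> \<zero>\<rbrakk> \<Longrightarrow> a \<otimes> b \<noteq> \<zero>"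

locale right_archimedean_ring = nonzero_ring R for R (structure) +
  assumes right_archimedean:
    "\<And>a. a \<in> carrier R - Units R \<Longrightarrow>
      (\<Inter>n\<in>{1::nat..}. {b \<otimes> a [^] n | b. b \<in> carrier R}) = {\<zero>}"

definition preserves_nonunits :: "('a, 'm) ring_scheme \<Rightarrow> ('a \<Rightarrow> 'a) \<Rightarrow> bool" where
  "preserves_nonunits R \<alpha> \<longleftrightarrow> \<alpha> ` (carrier R - Units R) \<subseteq> carrier R - Units R"

text \<open>
  Skew polynomials are represented, like the polynomials of \<^const>\<open>UP\<close>, by their finitely
  supported sequences of left coefficients.  Iterating \<open>x a = \<alpha>(a) x\<close> gives
  \<open>(a x\<^sup>i) (b x\<^sup>j) = a \<alpha>\<^sup>i(b) x\<^sup>i\<^sup>+\<^sup>j\<close>, hence the product below.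
\<close>

definition skew_UP :: "('a, 'm) ring_scheme \<Rightarrow> ('a \<Rightarrow> 'a) \<Rightarrow> (nat \<Rightarrow> 'a) ring" where
  "skew_UP R \<alpha> = \<lparr>
    carrier = up R,
    mult = (\<lambda>p\<in>up R. \<lambda>q\<in>up R. \<lambda>n. \<Oplus>\<^bsub>R\<^esub>i\<in>{..n}. p i \<otimes>\<^bsub>R\<^esub> (\<alpha> ^^ i) (q (n - i))),
    one = (\<lambda>i. if i = 0 then \<one>\<^bsub>R\<^esub> else \<zero>\<^bsub>R\<^esub>),
    zero = (\<lambda>i. \<zero>\<^bsub>R\<^esub>),
    add = (\<lambda>p\<in>up R. \<lambda>q\<in>up R. \<lambda>i. p i \<oplus>\<^bsub>R\<^esub> q i)\<rparr>"

locale skew_poly = ring R for R (structure) +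
  fixes \<alpha> :: "'a \<Rightarrow> 'a"
  assumes endo: "\<alpha> \<in> ring_hom R R"
begin

lemma endo_pow: "\<alpha> ^^ n \<in> ring_hom R R"
proof (induction n)
  case 0
  show ?case by (simp add: ring_hom_def)
next
  case (Suc n)
  then show ?case using endo by (auto simp: ring_hom_def Pi_iff)
qed

lemma pow_closed [simp]: "a \<in> carrier R \<Longrightarrow> (\<alpha> ^^ n) a \<in> carrier R"
  using ring_hom_closed[OF endo_pow] .

lemma pow_one [simp]: "(\<alpha> ^^ n) \<one> = \<one>"
  using ring_hom_one[OF endo_pow] .

lemma pow_zero [simp]: "(\<alpha> ^^ n) \<zero> = \<zero>"
  using ring_hom_zero[OF endo_pow ring_axioms ring_axioms] .

lemma pow_add [simp]: "\<lbrakk>a \<in> carrier R; b \<in> carrier R\<rbrakk> \<Longrightarrow>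
    (\<alpha> ^^ n) (a \<oplus> b) = (\<alpha> ^^ n) a \<oplus> (\<alpha> ^^ n) b"
  using ring_hom_add[OF endo_pow] .

lemma pow_mult [simp]: "\<lbrakk>a \<in> carrier R; b \<in> carrier R\<rbrakk> \<Longrightarrow>
    (\<alpha> ^^ n) (a \<otimes> b) = (\<alpha> ^^ n) a \<otimes> (\<alpha> ^^ n) b"
  using ring_hom_mult[OF endo_pow] .

lemma pow_sum:
  fixes m :: nat
  assumes "f \<in> {..m} \<rightarrow> carrier R"
  shows "(\<alpha> ^^ n) (\<Oplus>i\<in>{..m}. f i) = (\<Oplus>i\<in>{..m}. (\<alpha> ^^ n) (f i))"
  using assms by (induction m) (simp_all add: Pi_def)

lemma skew_mult_closed:
  assumes "p \<in> up R" "q \<in> up R"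
  shows "(\<lambda>n. \<Oplus>i\<in>{..n}. p i \<otimes> (\<alpha> ^^ i) (q (n - i))) \<in> up R"
proof
  show "(\<Oplus>i\<in>{..n}. p i \<otimes> (\<alpha> ^^ i) (q (n - i))) \<in> carrier R" for n
    using assms by (simp add: mem_upD Pi_iff)
next
  obtain n where n: "bound \<zero> n p" using assms by fast
  obtain m where m: "bound \<zero> m q" using assms by fast
  have "p i \<otimes> (\<alpha> ^^ i) (q (k - i)) = \<zero>" if "n + m < k" for k i
  proof (cases "n < i")
    case True
    then have "p i = \<zero>" using n by auto
    then show ?thesis using assms by (simp add: mem_upD)
  next
    case False
    with that have "m < k - i" by arith
    then have "q (k - i) = \<zero>" using m by auto
    then show ?thesis using assms by (simp add: mem_upD)
  qed
  then have "bound \<zero> (n + m) (\<lambda>n. \<Oplus>i\<in>{..n}. p i \<otimes> (\<alpha> ^^ i) (q (n - i)))"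
    by (auto simp: Pi_def)
  then show "\<exists>N. bound \<zero> N (\<lambda>n. \<Oplus>i\<in>{..n}. p i \<otimes> (\<alpha> ^^ i) (q (n - i)))" ..
qed

lemma finsum_triangle:
  assumes g: "\<And>i j. g i j \<in> carrier R"
  shows "(\<Oplus>j\<in>{..k}. \<Oplus>i\<in>{..j}. g i (j - i)) = (\<Oplus>j\<in>{..k}. \<Oplus>i\<in>{..k - j::nat}. g j i)"
proof (induction k)
  case 0
  then show ?case using g by (simp add: Pi_def)
next
  case (Suc k)
  have "(\<Oplus>j\<in>{..Suc k}. \<Oplus>i\<in>{..Suc k - j}. g j i) =
      g (Suc k) 0 \<oplus> (\<Oplus>j\<in>{..k}. \<Oplus>i\<in>{..Suc k - j}. g j i)"
    using g by (simp add: Pi_def)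
  also have "(\<Oplus>j\<in>{..k}. \<Oplus>i\<in>{..Suc k - j}. g j i) =
      (\<Oplus>j\<in>{..k}. g j (Suc k - j) \<oplus> (\<Oplus>i\<in>{..k - j}. g j i))"
    using g by (intro finsum_cong') (auto simp: Suc_diff_le Pi_def)
  also have "\<dots> = (\<Oplus>j\<in>{..k}. g j (Suc k - j)) \<oplus> (\<Oplus>j\<in>{..k}. \<Oplus>i\<in>{..k - j}. g j i)"
    using g by (simp add: Pi_def finsum_addf)
  finally show ?case using g by (simp add: Pi_def Suc.IH a_assoc)
qed

theorem ring_skew_UP: "ring (skew_UP R \<alpha>)"
proof (rule ringI)
  show "abelian_group (skew_UP R \<alpha>)"
  proof (rule abelian_groupI, goal_cases)
    case (6 p)
    then show ?case
      by (intro bexI[of _ "\<lambda>i. \<ominus> p i"])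
        (auto simp: skew_UP_def up_a_inv_closed mem_upD l_neg)
  qed (auto simp: skew_UP_def up_add_closed mem_upD a_ac)
  show "Group.monoid (skew_UP R \<alpha>)"
  proof (rule monoidI, goal_cases)
    case (3 p q r)
    then have R: "p \<in> up R" "q \<in> up R" "r \<in> up R" by (simp_all add: skew_UP_def)
    then have c: "p i \<in> carrier R" "q i \<in> carrier R" "r i \<in> carrier R" for i by auto
    have "(\<Oplus>j\<in>{..n}. (\<Oplus>i\<in>{..j}. p i \<otimes> (\<alpha> ^^ i) (q (j - i))) \<otimes> (\<alpha> ^^ j) (r (n - j))) =
        (\<Oplus>j\<in>{..n}. p j \<otimes> (\<alpha> ^^ j) (\<Oplus>i\<in>{..n - j}. q i \<otimes> (\<alpha> ^^ i) (r (n - j - i))))"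
      (is "?lhs = ?rhs") for n
    proof -
      let ?g = "\<lambda>i j. p i \<otimes> (\<alpha> ^^ i) (q j) \<otimes> (\<alpha> ^^ (i + j)) (r (n - (i + j)))"
      have "?lhs = (\<Oplus>j\<in>{..n}. \<Oplus>i\<in>{..j}. ?g i (j - i))"
        using c by (intro finsum_cong') (auto simp: finsum_ldistr Pi_def cong: finsum_cong)
      also have "\<dots> = (\<Oplus>j\<in>{..n}. \<Oplus>i\<in>{..n - j}. ?g j i)"
        using c by (intro finsum_triangle) auto
      also have "\<dots> = ?rhs"
        using c by (intro finsum_cong')
          (auto simp: pow_sum finsum_rdistr Pi_def funpow_add m_assoc cong: finsum_cong)
      finally show ?thesis .
    qed
    then show ?case using R by (simp add: skew_UP_def skew_mult_closed)
  next
    case (4 p)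
    then have R: "p \<in> up R" by (simp add: skew_UP_def)
    have "(\<Oplus>i\<in>{..n}. (if i = 0 then \<one> else \<zero>) \<otimes> (\<alpha> ^^ i) (p (n - i))) = p n" for n
    proof -
      have "(\<Oplus>i\<in>{..n}. (if i = 0 then \<one> else \<zero>) \<otimes> (\<alpha> ^^ i) (p (n - i))) =
          (\<Oplus>i\<in>{..n}. if 0 = i then p (n - i) else \<zero>)"
        using R by (intro finsum_cong') (auto simp: mem_upD)
      also have "\<dots> = p (n - 0)"
        using R by (intro finsum_singleton) (auto simp: mem_upD)
      finally show ?thesis by simp
    qed
    with R show ?case by (simp add: skew_UP_def up_one_closed)
  next
    case (5 p)
    then have R: "p \<in> up R" by (simp add: skew_UP_def)
    have "(\<Oplus>i\<in>{..n}. p i \<otimes> (\<alpha> ^^ i) (if n - i = 0 then \<one> else \<zero>)) = p n" for n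
    proof -
      have "(\<Oplus>i\<in>{..n}. p i \<otimes> (\<alpha> ^^ i) (if n - i = 0 then \<one> else \<zero>)) =
          (\<Oplus>i\<in>{..n}. if n = i then p i else \<zero>)"
        using R by (intro finsum_cong') (auto simp: mem_upD)
      then show ?thesis using R by (simp add: finsum_singleton mem_upD Pi_def)
    qed
    with R show ?case by (simp add: skew_UP_def up_one_closed)
  qed (auto simp: skew_UP_def up_one_closed skew_mult_closed)
next
  fix p q r
  assume "p \<in> carrier (skew_UP R \<alpha>)" "q \<in> carrier (skew_UP R \<alpha>)" "r \<in> carrier (skew_UP R \<alpha>)"
  then have R: "p \<in> up R" "q \<in> up R" "r \<in> up R" by (simp_all add: skew_UP_def)
  then have c: "p i \<in> carrier R" "q i \<in> carrier R" "r i \<in> carrier R" for i by auto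
  show "(p \<oplus>\<^bsub>skew_UP R \<alpha>\<^esub> q) \<otimes>\<^bsub>skew_UP R \<alpha>\<^esub> r =
      p \<otimes>\<^bsub>skew_UP R \<alpha>\<^esub> r \<oplus>\<^bsub>skew_UP R \<alpha>\<^esub> q \<otimes>\<^bsub>skew_UP R \<alpha>\<^esub> r"
    using R c by (simp add: skew_UP_def skew_mult_closed up_add_closed l_distr Pi_def finsum_addf cong: finsum_cong)
  show "r \<otimes>\<^bsub>skew_UP R \<alpha>\<^esub> (p \<oplus>\<^bsub>skew_UP R \<alpha>\<^esub> q) =
      r \<otimes>\<^bsub>skew_UP R \<alpha>\<^esub> p \<oplus>\<^bsub>skew_UP R \<alpha>\<^esub> r \<otimes>\<^bsub>skew_UP R \<alpha>\<^esub> q"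
    using R c by (simp add: skew_UP_def skew_mult_closed up_add_closed r_distr Pi_def finsum_addf cong: finsum_cong)
qed

lemma skew_monom_mult:
  assumes "a \<in> carrier R" "b \<in> carrier R"
  shows "monom (UP R) a i \<otimes>\<^bsub>skew_UP R \<alpha>\<^esub> monom (UP R) b j =
      monom (UP R) (a \<otimes> (\<alpha> ^^ i) b) (i + j)"
proof -
  have up: "(\<lambda>k. if k = n then c else \<zero>) \<in> up R" if "c \<in> carrier R" for c n
    using that by (force simp: up_def)
  have "(\<Oplus>l\<in>{..k}. (if l = i then a else \<zero>) \<otimes> (\<alpha> ^^ l) (if k - l = j then b else \<zero>)) =
      (if k = i + j then a \<otimes> (\<alpha> ^^ i) b else \<zero>)" (is "?lhs = _") for k
  proof -
    have "?lhs = (\<Oplus>l\<in>{..k}. if k = i + j \<and> i = l then a \<otimes> (\<alpha> ^^ i) b else \<zero>)"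
      using assms by (intro finsum_cong') auto
    then show ?thesis using assms by (cases "k = i + j") (simp_all add: finsum_singleton Pi_def)
  qed
  then show ?thesis using assms by (simp add: skew_UP_def UP_def up)
qed

end

end

theory Submission
  imports Defs "HOL-Algebra.Multiplicative_Group"
begin

text \<open>
  If \<open>a b = 0\<close> in \<open>R\<close>, then \<open>a (1 - b x)\<^sup>n = a\<close> for all \<open>n\<close>, so in a right Archimedean skew polynomial
  ring either \<open>a = 0\<close> or \<open>1 - b x\<close> is a unit.  In the latter case its inverse can only be the
  geometric series \<open>\<Sum> (b x)\<^sup>k\<close>; hence \<open>b x\<close> is nilpotent, and \<open>b = 0\<close> by reducedness.  Similarly
  \<open>x a\<^sup>n = \<alpha>(a)\<^sup>n x\<close> puts \<open>x\<close> into \<open>\<Inter> A a\<^sup>n\<close> as soon as \<open>\<alpha>(a)\<close> is a unit, so \<open>\<alpha>\<close> preserves nonunits.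
  Conversely, over a domain \<open>R\<close> with \<open>\<alpha>\<close> injective degrees add up: a nonconstant \<open>f\<close> is handled by
  degree, while for a constant \<open>a\<close> the \<open>i\<close>-th coefficients of the elements of \<open>A a\<^sup>n\<close> lie in
  \<open>R \<alpha>\<^sup>i(a)\<^sup>n\<close>, where \<open>\<alpha>\<^sup>i(a)\<close> is a nonunit.
\<close>

section \<open>Generalities on nonzero rings, the Archimedean condition and degrees\<close>

lemma (in noncomm_domain) reduced: "reduced_ring R"
proof
  fix a :: 'a and n :: nat
  assume a: "a \<in> carrier R" and "a [^] n = \<zero>"
  then show "a = \<zero>"
    by (induction n) (auto, metis mult_nonzero nat_pow_closed)
qed

lemma (in right_archimedean_ring) eq_zeroI:
  assumes "a \<in> carrier R" "a \<notin> Units R"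
    and "\<And>n::nat. \<exists>b\<in>carrier R. c = b \<otimes> a [^] n"
  shows "c = \<zero>"
proof -
  have "c \<in> (\<Inter>n\<in>{1::nat..}. {b \<otimes> a [^] n | b. b \<in> carrier R})"
    using assms(3) by blast
  then show ?thesis using right_archimedean[of a] assms by auto
qed

text \<open>Only one inclusion has content: 0 = 0 a^n always lies in the intersection, and exponent
  1 already places \<open>c\<close> in the carrier.\<close>

lemma (in nonzero_ring) right_archimedean_ringI:
  assumes "\<And>a c. \<lbrakk>a \<in> carrier R; a \<notin> Units R; c \<in> carrier R;
      \<And>n::nat. n \<ge> 1 \<Longrightarrow> \<exists>b\<in>carrier R. c = b \<otimes> a [^] n\<rbrakk> \<Longrightarrow> c = \<zero>"
  shows "right_archimedean_ring R"
proof
  fix a assume a: "a \<in> carrier R - Units R"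
  show "(\<Inter>n\<in>{1::nat..}. {b \<otimes> a [^] n | b. b \<in> carrier R}) = {\<zero>}" (is "?I = _")
  proof (intro equalityI subsetI)
    fix c assume c: "c \<in> ?I"
    have *: "\<exists>b\<in>carrier R. c = b \<otimes> a [^] n" if "n \<ge> 1" for n :: nat using c that by blast
    then have "c \<in> carrier R" using a by (metis DiffD1 order_refl m_closed nat_pow_closed)
    then show "c \<in> {\<zero>}" using assms[of a c] a * by blast
  next
    fix c assume "c \<in> {\<zero>}"
    moreover have "\<exists>b\<in>carrier R. \<zero> = b \<otimes> a [^] n" for n :: nat
      using a by (intro bexI[of _ \<zero>]) auto
    ultimately show "c \<in> ?I" by blast
  qed
qed

text \<open>Provides the degree \<open>d\<close> of a nonzero polynomial, in the form used for all
  degree arguments below.\<close>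

lemma ex_last_coeff:
  assumes "p \<in> up R" "p \<noteq> (\<lambda>i. \<zero>\<^bsub>R\<^esub>)"
  obtains d where "p d \<noteq> \<zero>\<^bsub>R\<^esub>" "\<forall>i>d. p i = \<zero>\<^bsub>R\<^esub>"
proof -
  obtain n where n: "bound \<zero>\<^bsub>R\<^esub> n p" using assms(1) by (auto simp: up_def)
  let ?P = "\<lambda>i. p i \<noteq> \<zero>\<^bsub>R\<^esub>"
  obtain k where "?P k" using assms(2) by auto
  moreover have b: "\<forall>i. ?P i \<longrightarrow> i \<le> n" using n by (meson bound.bound not_le_imp_less)
  ultimately have "?P (Greatest ?P)" by (intro GreatestI_nat[of ?P k n]) auto
  moreover have "p i = \<zero>\<^bsub>R\<^esub>" if "i > Greatest ?P" for i
    using Greatest_le_nat[of ?P i n] b that by (meson not_le)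
  ultimately show ?thesis using that by blast
qed

section \<open>Coefficients, constants and monomials in the skew polynomial ring\<close>

context skew_poly
begin

abbreviation S where "S \<equiv> skew_UP R \<alpha>"

abbreviation mon where "mon a n \<equiv> monom (UP R) a n"

sublocale S: ring S
  by (rule ring_skew_UP)

lemma carrier_skew: "carrier S = up R"
  by (simp add: skew_UP_def)

lemma zero_skew: "\<zero>\<^bsub>S\<^esub> = (\<lambda>i. \<zero>)"
  by (simp add: skew_UP_def)

lemma one_skew: "\<one>\<^bsub>S\<^esub> = mon \<one> 0"
  by (simp add: skew_UP_def UP_def fun_eq_iff)

lemma add_skew: "\<lbrakk>p \<in> carrier S; q \<in> carrier S\<rbrakk> \<Longrightarrow> (p \<oplus>\<^bsub>S\<^esub> q) n = p n \<oplus> q n"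
  by (simp add: skew_UP_def)

lemma mult_skew: "\<lbrakk>p \<in> carrier S; q \<in> carrier S\<rbrakk> \<Longrightarrow>
    (p \<otimes>\<^bsub>S\<^esub> q) n = (\<Oplus>i\<in>{..n}. p i \<otimes> (\<alpha> ^^ i) (q (n - i)))"
  by (simp add: skew_UP_def)

lemma coeff_closed [simp]: "p \<in> carrier S \<Longrightarrow> p n \<in> carrier R"
  by (auto simp: carrier_skew)

lemma mon_coeff: "a \<in> carrier R \<Longrightarrow> mon a n i = (if i = n then a else \<zero>)"
  by (simp add: UP_def)

lemma mon_closed [simp]: "a \<in> carrier R \<Longrightarrow> mon a n \<in> carrier S"
  by (simp add: carrier_skew UP_def) (force simp: up_def)

lemma mon_zero_iff [simp]: "a \<in> carrier R \<Longrightarrow> mon a n = \<zero>\<^bsub>S\<^esub> \<longleftrightarrow> a = \<zero>"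
  by (auto simp: mon_coeff zero_skew fun_eq_iff)

lemma mult_coeff_0:
  assumes "p \<in> carrier S" "q \<in> carrier S"
  shows "(p \<otimes>\<^bsub>S\<^esub> q) 0 = p 0 \<otimes> q 0"
  using assms by (simp add: mult_skew Pi_def)

lemma mon_mult_coeff:
  assumes "a \<in> carrier R" "p \<in> carrier S"
  shows "(mon a i \<otimes>\<^bsub>S\<^esub> p) n = (if n < i then \<zero> else a \<otimes> (\<alpha> ^^ i) (p (n - i)))"
proof -
  have "(mon a i \<otimes>\<^bsub>S\<^esub> p) n =
      (\<Oplus>l\<in>{..n}. if i = l then a \<otimes> (\<alpha> ^^ l) (p (n - l)) else \<zero>)"
    using assms by (simp add: mult_skew) (intro finsum_cong', auto simp: mon_coeff)
  also have "\<dots> = (if n < i then \<zero> else a \<otimes> (\<alpha> ^^ i) (p (n - i)))"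
  proof (cases "n < i")
    case True
    then have "(\<Oplus>l\<in>{..n}. if i = l then a \<otimes> (\<alpha> ^^ l) (p (n - l)) else \<zero>) = (\<Oplus>l\<in>{..n}. \<zero>)"
      using assms by (intro finsum_cong') auto
    with True show ?thesis by simp
  qed (use assms in \<open>simp add: finsum_singleton\<close>)
  finally show ?thesis .
qed

text \<open>Moving \<open>a\<close> to the left past x^n twists it by \<alpha>^n. Hence a left
  multiple of a constant can be studied one coefficient at a time in \<open>R\<close>.\<close>

lemma mult_const_coeff:
  assumes "a \<in> carrier R" "p \<in> carrier S"
  shows "(p \<otimes>\<^bsub>S\<^esub> mon a 0) n = p n \<otimes> (\<alpha> ^^ n) a"
proof -
  have "(p \<otimes>\<^bsub>S\<^esub> mon a 0) n = (\<Oplus>l\<in>{..n}. if n = l then p l \<otimes> (\<alpha> ^^ l) a else \<zero>)"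
    using assms by (simp add: mult_skew) (intro finsum_cong', auto simp: mon_coeff)
  then show ?thesis using assms by (simp add: finsum_singleton)
qed

lemma const_pow: "a \<in> carrier R \<Longrightarrow> mon a 0 [^]\<^bsub>S\<^esub> (n::nat) = mon (a [^] n) 0"
  by (induction n) (simp_all add: one_skew skew_monom_mult)

lemma pow_nat_pow: "a \<in> carrier R \<Longrightarrow> (\<alpha> ^^ i) (a [^] (n::nat)) = (\<alpha> ^^ i) a [^] n"
  by (induction n) simp_all

lemma Units_const_iff:
  assumes "a \<in> carrier R"
  shows "mon a 0 \<in> Units S \<longleftrightarrow> a \<in> Units R"
proof
  assume "mon a 0 \<in> Units S"
  then obtain g where g: "g \<in> carrier S" "g \<otimes>\<^bsub>S\<^esub> mon a 0 = \<one>\<^bsub>S\<^esub>" "mon a 0 \<otimes>\<^bsub>S\<^esub> g = \<one>\<^bsub>S\<^esub>"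
    unfolding Units_def by auto
  \<comment> \<open>Constant terms multiply, so \<open>g 0\<close> inverts \<open>a\<close> whatever
    the higher coefficients of \<open>g\<close> are.\<close>
  have "g 0 \<otimes> a = \<one>" "a \<otimes> g 0 = \<one>"
    using g assms mult_coeff_0[of g "mon a 0"] mult_coeff_0[of "mon a 0" g]
    by (simp_all add: one_skew mon_coeff)
  then show "a \<in> Units R" using assms g(1) unfolding Units_def by auto
next
  assume a: "a \<in> Units R"
  have "mon (inv a) 0 \<otimes>\<^bsub>S\<^esub> mon a 0 = \<one>\<^bsub>S\<^esub>" "mon a 0 \<otimes>\<^bsub>S\<^esub> mon (inv a) 0 = \<one>\<^bsub>S\<^esub>"
    using a assms by (simp_all add: skew_monom_mult one_skew)
  then show "mon a 0 \<in> Units S"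
    using a assms unfolding Units_def[of S] by auto
qed

lemma inj_onI_kernel:
  assumes "\<And>a. \<lbrakk>a \<in> carrier R; \<alpha> a = \<zero>\<rbrakk> \<Longrightarrow> a = \<zero>"
  shows "inj_on \<alpha> (carrier R)"
proof (rule inj_onI)
  fix a b assume ab: "a \<in> carrier R" "b \<in> carrier R" "\<alpha> a = \<alpha> b"
  have cl: "\<alpha> c \<in> carrier R" if "c \<in> carrier R" for c using ring_hom_closed[OF endo that] .
  have diff: "a \<ominus> b \<oplus> b = a" using ab by (simp add: a_minus_def a_assoc l_neg)
  have "\<alpha> (a \<ominus> b) \<oplus> \<alpha> b = \<alpha> (a \<ominus> b \<oplus> b)"
    using ring_hom_add[OF endo, of "a \<ominus> b" b] ab by simp
  then have "\<alpha> (a \<ominus> b) \<oplus> \<alpha> b = \<zero> \<oplus> \<alpha> b" using ab cl by (simp add: diff)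
  then have "\<alpha> (a \<ominus> b) = \<zero>" using ab cl by (simp del: l_zero)
  then have "a \<ominus> b = \<zero>" using assms ab by simp
  then show "a = b" using diff ab by simp
qed

lemma pow_eq_zero_iff:
  assumes "inj_on \<alpha> (carrier R)" "a \<in> carrier R"
  shows "(\<alpha> ^^ n) a = \<zero> \<longleftrightarrow> a = \<zero>"
proof (induction n)
  case (Suc n)
  have "\<alpha> ((\<alpha> ^^ n) a) = \<alpha> \<zero> \<longleftrightarrow> (\<alpha> ^^ n) a = \<zero>"
    using assms by (intro inj_on_eq_iff) auto
  then show ?case using Suc ring_hom_zero[OF endo ring_axioms ring_axioms] by simp
qed simp

section \<open>From the skew polynomial ring down to the base ring\<close>

text \<open>Comparing coefficients in g = 1 + (b x) g gives g_0 = 1 and g_(n+1) = b \<alpha>(g_n),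
  which is also the recursion for the coefficient of (b x)^n.\<close>

lemma geometric_inverse_coeff:
  assumes b: "b \<in> carrier R" and g: "g \<in> carrier S"
    and inv: "(\<one>\<^bsub>S\<^esub> \<ominus>\<^bsub>S\<^esub> mon b 1) \<otimes>\<^bsub>S\<^esub> g = \<one>\<^bsub>S\<^esub>"
  shows "mon b 1 [^]\<^bsub>S\<^esub> (n::nat) = mon (g n) n"
proof -
  have "g = \<one>\<^bsub>S\<^esub> \<oplus>\<^bsub>S\<^esub> mon b 1 \<otimes>\<^bsub>S\<^esub> g"
  proof -
    have "(\<one>\<^bsub>S\<^esub> \<ominus>\<^bsub>S\<^esub> mon b 1) \<otimes>\<^bsub>S\<^esub> g \<oplus>\<^bsub>S\<^esub> mon b 1 \<otimes>\<^bsub>S\<^esub> g = g"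
      using b g by (simp add: S.l_distr[symmetric] a_minus_def S.a_assoc S.l_neg)
    then show ?thesis using inv by simp
  qed
  then have rec: "g n = \<one>\<^bsub>S\<^esub> n \<oplus> (mon b 1 \<otimes>\<^bsub>S\<^esub> g) n" for n
    using b g add_skew[of "\<one>\<^bsub>S\<^esub>" "mon b 1 \<otimes>\<^bsub>S\<^esub> g" n] by (metis S.m_closed S.one_closed mon_closed)
  show ?thesis
  proof (induction n)
    case 0
    have "g 0 = \<one>" using rec[of 0] b g by (simp add: mon_mult_coeff one_skew mon_coeff)
    then show ?case by (simp add: one_skew)
  next
    case (Suc n)
    have "g (Suc n) = b \<otimes> \<alpha> (g n)" using rec[of "Suc n"] b g ring_hom_closed[OF endo]
      by (simp add: mon_mult_coeff one_skew mon_coeff)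
    \<comment> \<open>The new factor is split off on the left, so that x passes over
      \<open>g n\<close> and produces the same \<alpha> as the recursion.\<close>
    moreover have "mon b 1 [^]\<^bsub>S\<^esub> Suc n = mon b 1 \<otimes>\<^bsub>S\<^esub> mon (g n) n"
      using b Suc by (metis S.nat_pow_Suc2 mon_closed)
    ultimately show ?case using b g by (simp add: skew_monom_mult)
  qed
qed

lemma noncomm_domain_base:
  assumes "reduced_ring S" "right_archimedean_ring S"
  shows "noncomm_domain R"
proof -
  interpret red: reduced_ring S by fact
  interpret arch: right_archimedean_ring S by fact
  show ?thesis
  proof
    show "\<one> \<noteq> \<zero>" using red.one_not_zero by (simp add: one_skew)
  next
    fix a b assume a: "a \<in> carrier R" and b: "b \<in> carrier R" and nz: "a \<noteq> \<zero>" "b \<noteq> \<zero>"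
    show "a \<otimes> b \<noteq> \<zero>"
    proof
      assume ab: "a \<otimes> b = \<zero>"
      define f where "f = \<one>\<^bsub>S\<^esub> \<ominus>\<^bsub>S\<^esub> mon b 1"
      have f: "f \<in> carrier S" using b by (simp add: f_def)
      have "mon a 0 \<otimes>\<^bsub>S\<^esub> mon b 1 = \<zero>\<^bsub>S\<^esub>" using a b ab by (simp add: skew_monom_mult)
      then have "mon a 0 \<otimes>\<^bsub>S\<^esub> f = mon a 0"
        using a b by (simp add: f_def a_minus_def S.r_distr S.r_minus)
      \<comment> \<open>This puts the nonzero constant \<open>a\<close> into every left ideal
        generated by a power of \<open>f\<close>, so \<open>f\<close> cannot be a nonunit.\<close>
      then have "mon a 0 \<otimes>\<^bsub>S\<^esub> f [^]\<^bsub>S\<^esub> n = mon a 0" for n :: nat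
        using a f by (induction n) (simp_all add: S.m_assoc[symmetric])
      then have "f \<in> Units S"
        using arch.eq_zeroI[OF f, of "mon a 0"] a nz(1) by (metis mon_closed mon_zero_iff)
      then obtain g where g: "g \<in> carrier S" "f \<otimes>\<^bsub>S\<^esub> g = \<one>\<^bsub>S\<^esub>" unfolding Units_def by auto
      \<comment> \<open>The inverse \<open>g\<close> is a polynomial, so its coefficients vanish
        beyond some \<open>n\<close>; by the geometric recursion so does (b x)^(n+1).\<close>
      obtain n where "bound \<zero> n g" using g(1) by (auto simp: carrier_skew)
      then have "g (Suc n) = \<zero>" by auto
      then have "mon b 1 [^]\<^bsub>S\<^esub> Suc n = \<zero>\<^bsub>S\<^esub>"
        using geometric_inverse_coeff[OF b g(1), of "Suc n"] g(2) by (simp add: f_def del: S.nat_pow_Suc One_nat_def)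
      then show False using red.nilpotent_imp_zero[of "mon b 1"] b nz(2) mon_closed mon_zero_iff
        by metis
    qed
  qed
qed

text \<open>If \<alpha>(a) = 0, then (a x)^2 = a \<alpha>(a) x^2 = 0.\<close>

lemma inj_on_of_reduced:
  assumes "reduced_ring S"
  shows "inj_on \<alpha> (carrier R)"
proof (rule inj_onI_kernel)
  interpret red: reduced_ring S by fact
  fix a assume a: "a \<in> carrier R" "\<alpha> a = \<zero>"
  then have "mon a 1 [^]\<^bsub>S\<^esub> (2::nat) = \<zero>\<^bsub>S\<^esub>"
    by (simp add: numeral_2_eq_2 skew_monom_mult)
  then show "a = \<zero>" using red.nilpotent_imp_zero[of "mon a 1"] a by (metis mon_closed mon_zero_iff)
qed

text \<open>Constants multiply as in \<open>R\<close>, and a nonunit of \<open>R\<close> stays a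
  nonunit as a constant polynomial.\<close>

lemma right_archimedean_base:
  assumes "right_archimedean_ring S"
  shows "right_archimedean_ring R"
proof -
  interpret arch: right_archimedean_ring S by fact
  interpret nonzero_ring R
    by standard (use arch.one_not_zero in \<open>simp add: one_skew\<close>)
  show ?thesis
  proof (rule right_archimedean_ringI)
    fix a c assume a: "a \<in> carrier R" "a \<notin> Units R" and c: "c \<in> carrier R"
      and *: "\<And>n::nat. n \<ge> 1 \<Longrightarrow> \<exists>b\<in>carrier R. c = b \<otimes> a [^] n"
    have "mon c 0 = \<zero>\<^bsub>S\<^esub>"
    proof (rule arch.eq_zeroI[of "mon a 0"])
      fix n :: nat
      have "\<exists>b\<in>carrier R. c = b \<otimes> a [^] n"
        using * c by (cases "n = 0") (auto intro!: bexI[of _ c])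
      then obtain b where b: "b \<in> carrier R" "c = b \<otimes> a [^] n" ..
      then show "\<exists>q\<in>carrier S. mon c 0 = q \<otimes>\<^bsub>S\<^esub> mon a 0 [^]\<^bsub>S\<^esub> n"
        using a by (intro bexI[of _ "mon b 0"]) (simp_all add: const_pow skew_monom_mult)
    qed (use a Units_const_iff in auto)
    then show "c = \<zero>" using c by simp
  qed
qed

lemma preserves_nonunits_of_right_archimedean:
  assumes "right_archimedean_ring S"
  shows "preserves_nonunits R \<alpha>"
proof -
  interpret arch: right_archimedean_ring S by fact
  have "\<alpha> a \<notin> Units R" if a: "a \<in> carrier R" "a \<notin> Units R" for a
  proof
    assume u: "\<alpha> a \<in> Units R"
    have cl: "\<alpha> a \<in> carrier R" using ring_hom_closed[OF endo a(1)] .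
    have "mon \<one> 1 = \<zero>\<^bsub>S\<^esub>"
    proof (rule arch.eq_zeroI[of "mon a 0"])
      fix n :: nat
      \<comment> \<open>With \<open>v\<close> a left inverse of \<alpha>(a)^n, one gets (v x) a^n =
        v \<alpha>(a)^n x = x.\<close>
      obtain v where v: "v \<in> carrier R" "v \<otimes> \<alpha> a [^] n = \<one>"
        using Units_pow_closed[OF u, of n] unfolding Units_def by auto
      have "mon v 1 \<otimes>\<^bsub>S\<^esub> mon a 0 [^]\<^bsub>S\<^esub> n = mon \<one> 1"
        using v a pow_nat_pow[OF a(1), of 1 n] by (simp add: const_pow skew_monom_mult)
      then show "\<exists>q\<in>carrier S. mon \<one> 1 = q \<otimes>\<^bsub>S\<^esub> mon a 0 [^]\<^bsub>S\<^esub> n"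
        using v by (metis mon_closed)
    qed (use a Units_const_iff in auto)
    then show False using arch.one_not_zero by (simp add: one_skew)
  qed
  then show ?thesis
    using ring_hom_closed[OF endo] by (auto simp: preserves_nonunits_def)
qed

section \<open>Degrees, and the way back up from the base ring\<close>

text \<open>Degrees add: the top coefficient is \<open>p d\<close> times \<alpha>^d of
  \<open>q e\<close>, nonzero because \<alpha>^d has trivial kernel and \<open>R\<close> is a
  domain.\<close>

lemma last_coeff_mult:
  assumes "noncomm_domain R" "inj_on \<alpha> (carrier R)"
    and p: "p \<in> carrier S" "p d \<noteq> \<zero>" "\<forall>i>d. p i = \<zero>"
    and q: "q \<in> carrier S" "q e \<noteq> \<zero>" "\<forall>i>e. q i = \<zero>"
  shows "(p \<otimes>\<^bsub>S\<^esub> q) (d + e) \<noteq> \<zero>" "\<forall>i>d + e. (p \<otimes>\<^bsub>S\<^esub> q) i = \<zero>"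
proof -
  interpret noncomm_domain R by fact
  have van: "p l \<otimes> (\<alpha> ^^ l) (q (n - l)) = \<zero>" if "d < l \<or> e < n - l" for n l
    using that p q by auto
  have "(p \<otimes>\<^bsub>S\<^esub> q) (d + e) =
      (\<Oplus>l\<in>{..d + e}. if d = l then p l \<otimes> (\<alpha> ^^ l) (q (d + e - l)) else \<zero>)"
    unfolding mult_skew[OF p(1) q(1)]
  proof (intro finsum_cong')
    fix l assume "l \<in> {..d + e}"
    show "p l \<otimes> (\<alpha> ^^ l) (q (d + e - l)) =
        (if d = l then p l \<otimes> (\<alpha> ^^ l) (q (d + e - l)) else \<zero>)"
      \<comment> \<open>For l > d the factor \<open>p l\<close> vanishes; for l < d the index d + e
        - l exceeds \<open>e\<close>.\<close>
      using van[of l "d + e"] by (cases l d rule: linorder_cases) auto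
  qed (use p q in auto)
  also have "\<dots> = p d \<otimes> (\<alpha> ^^ d) (q e)"
    using p q by (simp add: finsum_singleton)
  finally show "(p \<otimes>\<^bsub>S\<^esub> q) (d + e) \<noteq> \<zero>"
    using p q assms(2) by (simp add: mult_nonzero pow_eq_zero_iff)
  show "\<forall>i>d + e. (p \<otimes>\<^bsub>S\<^esub> q) i = \<zero>"
  proof (intro allI impI)
    fix n assume "d + e < n"
    then have "(p \<otimes>\<^bsub>S\<^esub> q) n = (\<Oplus>l\<in>{..n}. \<zero>)"
      unfolding mult_skew[OF p(1) q(1)] by (intro finsum_cong') (auto intro!: van)
    then show "(p \<otimes>\<^bsub>S\<^esub> q) n = \<zero>" by simp
  qed
qed

lemma last_coeff_pow:
  assumes "noncomm_domain R" "inj_on \<alpha> (carrier R)"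
    and p: "p \<in> carrier S" "p d \<noteq> \<zero>" "\<forall>i>d. p i = \<zero>"
  shows "(p [^]\<^bsub>S\<^esub> n) (n * d) \<noteq> \<zero> \<and> (\<forall>i>n * d. (p [^]\<^bsub>S\<^esub> n) i = \<zero>)"
proof (induction n)
  case 0
  interpret noncomm_domain R by fact
  show ?case by (simp add: one_skew mon_coeff)
next
  case (Suc n)
  then show ?case
    using last_coeff_mult[OF assms(1,2) _ _ _ p, of "p [^]\<^bsub>S\<^esub> n" "n * d"] p
    by (simp add: add.commute)
qed

lemma noncomm_domain_skew:
  assumes "noncomm_domain R" "inj_on \<alpha> (carrier R)"
  shows "noncomm_domain S"
proof
  interpret noncomm_domain R by fact
  show "\<one>\<^bsub>S\<^esub> \<noteq> \<zero>\<^bsub>S\<^esub>" by (simp add: one_skew)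
  fix p q assume pq: "p \<in> carrier S" "q \<in> carrier S" "p \<noteq> \<zero>\<^bsub>S\<^esub>" "q \<noteq> \<zero>\<^bsub>S\<^esub>"
  obtain d where d: "p d \<noteq> \<zero>" "\<forall>i>d. p i = \<zero>"
    using ex_last_coeff[of p R] pq by (auto simp: carrier_skew zero_skew)
  obtain e where e: "q e \<noteq> \<zero>" "\<forall>i>e. q i = \<zero>"
    using ex_last_coeff[of q R] pq by (auto simp: carrier_skew zero_skew)
  show "p \<otimes>\<^bsub>S\<^esub> q \<noteq> \<zero>\<^bsub>S\<^esub>"
    using last_coeff_mult(1)[OF assms pq(1) d pq(2) e] by (auto simp: zero_skew)
qed

lemma right_archimedean_skew:
  assumes dom: "noncomm_domain R" and inj: "inj_on \<alpha> (carrier R)"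
    and "right_archimedean_ring R" and pres: "preserves_nonunits R \<alpha>"
  shows "right_archimedean_ring S"
proof -
  interpret arch: right_archimedean_ring R by fact
  interpret Sdom: noncomm_domain S using noncomm_domain_skew[OF dom inj] .
  show ?thesis
  proof (rule Sdom.right_archimedean_ringI, rule ccontr)
    fix f h
    assume f: "f \<in> carrier S" "f \<notin> Units S" and h: "h \<in> carrier S" "h \<noteq> \<zero>\<^bsub>S\<^esub>"
      and *: "\<And>n::nat. n \<ge> 1 \<Longrightarrow> \<exists>g\<in>carrier S. h = g \<otimes>\<^bsub>S\<^esub> f [^]\<^bsub>S\<^esub> n"
    have "f \<noteq> \<zero>\<^bsub>S\<^esub>" using *[of 1] h by auto
    then obtain d where d: "f d \<noteq> \<zero>" "\<forall>i>d. f i = \<zero>"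
      using ex_last_coeff[of f R] f by (auto simp: carrier_skew zero_skew)
    show False
    proof (cases "d = 0")
      case True
      define a where "a = f 0"
      have a: "a \<in> carrier R" using f by (simp add: a_def)
      have fa: "f = mon a 0" using d True a by (auto simp: fun_eq_iff mon_coeff a_def)
      \<comment> \<open>Coefficient \<open>i\<close> involves \<alpha>^i(a), so the preservation of
        nonunits has to be iterated.\<close>
      have nu: "(\<alpha> ^^ i) a \<in> carrier R - Units R" for i
      proof (induction i)
        case 0
        show ?case using f(2) a Units_const_iff by (simp add: fa)
      next
        case (Suc i)
        then show ?case using pres by (auto simp: preserves_nonunits_def)
      qed
      have "h i = \<zero>" for i
      proof (rule arch.eq_zeroI[of "(\<alpha> ^^ i) a"])
        fix n :: nat
        show "\<exists>b\<in>carrier R. h i = b \<otimes> (\<alpha> ^^ i) a [^] n"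
        proof (cases "n = 0")
          case True
          then show ?thesis using h by (intro bexI[of _ "h i"]) auto
        next
          case False
          then obtain g where "g \<in> carrier S" "h = g \<otimes>\<^bsub>S\<^esub> f [^]\<^bsub>S\<^esub> n" using *[of n] by auto
          then show ?thesis using a
            by (intro bexI[of _ "g i"]) (simp_all add: fa const_pow mult_const_coeff pow_nat_pow)
        qed
      qed (use nu in auto)
      then show False using h by (simp add: zero_skew fun_eq_iff)
    next
      case False
      obtain m where m: "h m \<noteq> \<zero>" "\<forall>i>m. h i = \<zero>"
        using ex_last_coeff[of h R] h by (auto simp: carrier_skew zero_skew)
      \<comment> \<open>The exponent is chosen to exceed the degree \<open>m\<close> of
        \<open>h\<close>: since d >= 1, the product has degree e + (m + 1) d > m.\<close>
      obtain g where g: "g \<in> carrier S" "h = g \<otimes>\<^bsub>S\<^esub> f [^]\<^bsub>S\<^esub> Suc m" using *[of "Suc m"] by auto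
      then have "g \<noteq> \<zero>\<^bsub>S\<^esub>" using h f by (auto simp del: S.nat_pow_Suc)
      then obtain e where e: "g e \<noteq> \<zero>" "\<forall>i>e. g i = \<zero>"
        using ex_last_coeff[of g R] g by (auto simp: carrier_skew zero_skew)
      have "h (e + Suc m * d) \<noteq> \<zero>"
        using last_coeff_mult(1)[OF dom inj g(1) e] last_coeff_pow[OF dom inj f(1) d, of "Suc m"]
          f(1) g(2) S.nat_pow_closed by blast
      moreover have "m < e + Suc m * d" using False by (cases d) auto
      ultimately show False using m by blast
    qed
  qed
qed

end

theorem theorem3p3:
  fixes R :: "('a, 'm) ring_scheme" and \<alpha> :: "'a \<Rightarrow> 'a"
  assumes "nonzero_ring R"
    and "\<alpha> \<in> ring_hom R R"
  shows "(reduced_ring (skew_UP R \<alpha>) \<and> right_archimedean_ring (skew_UP R \<alpha>) \<longleftrightarrow>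
          noncomm_domain (skew_UP R \<alpha>) \<and> right_archimedean_ring (skew_UP R \<alpha>))
       \<and> (noncomm_domain (skew_UP R \<alpha>) \<and> right_archimedean_ring (skew_UP R \<alpha>) \<longleftrightarrow>
          noncomm_domain R \<and> right_archimedean_ring R \<and>
          inj_on \<alpha> (carrier R) \<and> preserves_nonunits R \<alpha>)"
proof -
  interpret nonzero_ring R by fact
  interpret skew_poly R \<alpha> by standard fact
  \<comment> \<open>The implications close the cycle (i) to (iii) to (ii) to (i), the last one
    because domains are reduced.\<close>
  show ?thesis
    using noncomm_domain.reduced[of S] noncomm_domain_base inj_on_of_reduced right_archimedean_base
      preserves_nonunits_of_right_archimedean noncomm_domain_skew right_archimedean_skew
    by blast
qed

end
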